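(* In the setting described in the context, the controlled Euler--Poincar\'e equations $$\dot p_\alpha=-\mathcal B^i_{\alpha\beta}(\Gamma)\,p_i\,v^\beta-\mathcal K^k_{\alpha j}\frac{\partial U}{\partial\Gamma_j}\Gamma_k,\qquad \dot\pi_a=u_a,\qquad \dot\Gamma_i=-\varkappa^k_{i\beta}(\Gamma)\,v^\beta\,\Gamma_k\tag{C}$$ and the (uncontrolled) Euler--Poincar\'e equations with the reduced controlled Lagrangian $\tilde\ell_{\rm r}$, $$\dot{\tilde p}_\alpha=-\mathcal B^i_{\alpha\beta}(\Gamma)\,v^\beta\,\tilde p_i-\mathcal K^k_{\alpha j}\frac{\partial U}{\partial\Gamma_j}\Gamma_k,\qquad \dot{\tilde\pi}_a=0,\qquad \dot\Gamma_i=-\varkappa^k_{i\beta}(\Gamma)\,v^\beta\,\Gamma_k,\tag{M}$$ coincide (as equations for $(v^\alpha,\dot\theta^a,\Gamma)$) if $$\tau^a_i=-\sigma^{ab}\mathbb G_{bi}\qquad\text{and}\qquad\sigma^{ab}+\rho^{ab}=\mathbb G^{ab},$$ where the resulting control law is $$u_a=\mathbb G_{ab}\left(\mathcal T^b_i\,\mathcal F^i_{\alpha\beta}\,v^\alpha v^\beta-\mathcal T^b_\alpha\,\dot v^\alpha\right).$$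
   Context: Einstein's summation convention is used. $\mathfrak s$ is the $n$-dimensional Lie algebra of a Lie group with a linear representation on a finite-dimensional real vector space $X$; $\xi\mathsf x:=\frac{d}{d\varepsilon}\big|_{\varepsilon=0}\exp(\varepsilon\xi)\mathsf x$ for $\mathsf x\in X$, and $\langle\xi\gamma,\mathsf x\rangle=-\langle\gamma,\xi\mathsf x\rangle$ for $\gamma\in X^*$. The map $\mathbf K\colon X\times X^*\to\mathfrak s^*$ is $\langle\mathbf K(\mathsf x,\Gamma),\xi\rangle=\langle\Gamma,\xi\mathsf x\rangle$. **Constraint-adapted basis.** $\mathfrak d(\Gamma)\subset\mathfrak s$ is a $\Gamma$-dependent constraint subspace of codimension $r$ ($\Gamma\in X^*$), and $\{\mathcal E_i(\Gamma)\}_{i=1}^n$ is a basis of $\mathfrak s$, smooth in $\Gamma$, with $\mathfrak d(\Gamma)=\operatorname{span}\{\mathcal E_\alpha(\Gamma)\}_{\alpha=1}^{n-r}$. Greek indices run over $1,\dots,n-r$; $i,j,k,\dots$ of $\mathfrak s$-type over $1,\dots,n$; components of $\Gamma$ over $1,\dots,\dim X$. Fix a $\Gamma$-independent basis $\{E_i\}$ of $\mathfrak s$, write $\xi=\xi^iE_i$, $\mathcal E_j=\mathcal E^i_jE_i$, $E_i=(\mathcal E^{-1})^j_i\mathcal E_j$, and $\xi=v^i\mathcal E_i(\Gamma)$ ($v^i$ are quasivelocities; the constraint $\xi\in\mathfrak d(\Gamma)$ means $\xi=v^\alpha\mathcal E_\alpha(\Gamma)$). The subscript $(\,\cdot\,)|_{\rm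 c}$ means the constraint $\xi=v^\alpha\mathcal E_\alpha(\Gamma)$ is imposed after computing the expression. $\mathcal C^k_{ij}(\Gamma)$ is defined by $[\mathcal E_i,\mathcal E_j]=\mathcal C^k_{ij}\mathcal E_k$. With a basis $\{\mathbf e_i\}$ of $X$ and dual basis $\{\mathbf e^i_*\}$, $\Gamma=\Gamma_i\mathbf e^i_*$ and $\xi\Gamma=\kappa^k_{ij}\xi^j\Gamma_k\mathbf e^i_*$ define the constants $\kappa^k_{ij}$. Then $$\mathcal K^k_{ij}:=\langle\mathbf K(\mathbf e_j,\mathbf e^k_* ),\mathcal E_i\rangle,\quad \varkappa^k_{i\beta}:=\kappa^k_{ij}\mathcal E^j_\beta,\quad \mathcal F^i_{\alpha\beta}:=\frac{\partial\mathcal E^l_\alpha}{\partial\Gamma_j}(\mathcal E^{-1})^i_l\,\varkappa^k_{j\beta}\Gamma_k,\quad \mathcal B^i_{\alpha\beta}:=\mathcal C^i_{\alpha\beta}+\mathcal F^i_{\alpha\beta}.$$ **Lagrangian with rotors.** $\mathfrak h\cong\mathbb R^{s}$ is the Lie algebra of an $s$-dimensional Abelian Lie group (internal rotors); indices $a,b,c,d$ run over $1,\dots,s$ and $\dot\theta=(\dot\theta^a)\in\mathfrak h$. The reduced Lagrangian is $\ell_{\rm r}(\xi,\dot\theta^a,\Gamma)=K(\xi,\dot\theta^a)-U(\Gamma)$ with $U\colon X^*\to\mathbb R$ smooth and $$K(\xi,\dot\theta^a)=\tfrac12\mathbb G_{ij}\xi^i\xi^j+\mathbb G_{ia}\xi^i\dot\theta^a+\tfrac12\mathbb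 G_{ab}\dot\theta^a\dot\theta^b,$$ where $\mathbb G_{ij}$, $\mathbb G_{ia}$, $\mathbb G_{ab}$ are constant, $\mathbb G_{ij}=\mathbb G_{ji}$, $\mathbb G_{ab}=\mathbb G_{ba}$, $\mathbb G_{ai}=\mathbb G_{ia}$. Put $p_i:=\big\langle\frac{\delta\ell_{\rm r}}{\delta\xi}\big|_{\rm c},\mathcal E_i\big\rangle$ and $\pi_a:=\frac{\partial\ell_{\rm r}}{\partial\dot\theta^a}\big|_{\rm c}$; these are functions of $(v^\alpha,\dot\theta^a,\Gamma)$. $u_a$ are control inputs (torques) applied to the rotors. **Controlled Lagrangian.** $\tilde\ell_{\rm r}(\xi,\dot\theta^a,\Gamma)=\tilde K(\xi,\dot\theta^a)-U(\Gamma)$ with $$\tilde K(\xi,\dot\theta^a)=K(\xi^i,\dot\theta^a+\tau^a_i\xi^i)+\tfrac12\sigma_{ab}\tau^a_i\tau^b_j\xi^i\xi^j+\tfrac12(\rho_{ab}-\mathbb G_{ab})\bigl(\dot\theta^a+(\mathbb G^{ac}\mathbb G_{ci}+\tau^a_i)\xi^i\bigr)\bigl(\dot\theta^b+(\mathbb G^{bc}\mathbb G_{cj}+\tau^b_j)\xi^j\bigr),$$ where $\tau^a_i,\sigma_{ab},\rho_{ab}$ are constant matrices, with $\sigma_{ab},\rho_{ab}$ symmetric. $\mathbb G^{ab},\sigma^{ab},\rho^{ab}$ denote the inverse matrices of $\mathbb G_{ab},\sigma_{ab},\rho_{ab}$ (all assumed invertible). Put $\tilde p_i:=\big\langle\frac{\delta\tilde\ell_{\rm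 r}}{\delta\xi}\big|_{\rm c},\mathcal E_i\big\rangle$, $\tilde\pi_a:=\frac{\partial\tilde\ell_{\rm r}}{\partial\dot\theta^a}\big|_{\rm c}$, and $\mathcal T^a_i(\Gamma):=\tau^a_j\,\mathcal E^j_i(\Gamma)$. *)

theory Defs
  imports "HOL-Analysis.Analysis" "HOL-Algebra.Group"
begin

(* Smoothness is meant for maps on open subsets of finite-dimensional spaces: f is C^(k+1) iff it is
   differentiable and all its directional derivatives are C^k. *)

primrec Ck_on :: "nat \<Rightarrow> 'a::real_normed_vector set \<Rightarrow> ('a \<Rightarrow> 'b::real_normed_vector) \<Rightarrow> bool" where
  "Ck_on 0 S f \<longleftrightarrow> continuous_on S f"
| "Ck_on (Suc k) S f \<longleftrightarrow>
     (\<forall>x\<in>S. f differentiable (at x)) \<and> (\<forall>v. Ck_on k S (\<lambda>x. frechet_derivative f (at x) v))"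

definition smooth_on :: "'a::real_normed_vector set \<Rightarrow> ('a \<Rightarrow> 'b::real_normed_vector) \<Rightarrow> bool" where
  "smooth_on S f \<longleftrightarrow> (\<forall>k. Ck_on k S f)"

(* Bases are indexed from 1, so that sums over indices can be copied verbatim. *)

definition is_basis :: "nat \<Rightarrow> (nat \<Rightarrow> 'a::real_vector) \<Rightarrow> bool" where
  "is_basis n B \<longleftrightarrow> inj_on B {1..n} \<and> independent (B ` {1..n}) \<and> span (B ` {1..n}) = UNIV"

definition coord :: "nat \<Rightarrow> (nat \<Rightarrow> 'a::real_vector) \<Rightarrow> 'a \<Rightarrow> nat \<Rightarrow> real" where
  "coord n B x i = representation (B ` {1..n}) x (B i)"


type_synonym ('g, 'm) atlas = "('g set \<times> ('g \<Rightarrow> 'm)) set"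

definition smooth_atlas :: "'g topology \<Rightarrow> ('g, 'm::euclidean_space) atlas \<Rightarrow> bool" where
  "smooth_atlas T A \<longleftrightarrow>
     (\<Union>(U,\<phi>)\<in>A. U) = topspace T \<and>
     (\<forall>(U,\<phi>)\<in>A. openin T U \<and> open (\<phi> ` U) \<and>
        homeomorphic_map (subtopology T U) (top_of_set (\<phi> ` U)) \<phi>) \<and>
     (\<forall>(U,\<phi>)\<in>A. \<forall>(V,\<psi>)\<in>A. smooth_on (\<phi> ` (U \<inter> V)) (\<lambda>x. \<psi> (inv_into U \<phi> x)))"

definition smooth_fun :: "('g, 'm::euclidean_space) atlas \<Rightarrow> ('g \<Rightarrow> 'b::real_normed_vector) \<Rightarrow> bool" where
  "smooth_fun A f \<longleftrightarrow> (\<forall>(U,\<phi>)\<in>A. smooth_on (\<phi> ` U) (\<lambda>x. f (inv_into U \<phi> x)))"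

definition lie_group :: "'g monoid \<Rightarrow> 'g topology \<Rightarrow> ('g, 'm::euclidean_space) atlas \<Rightarrow> bool" where
  "lie_group G T A \<longleftrightarrow>
     group G \<and> topspace T = carrier G \<and> Hausdorff_space T \<and> second_countable T \<and> smooth_atlas T A \<and>
     continuous_map (prod_topology T T) T (\<lambda>(x,y). x \<otimes>\<^bsub>G\<^esub> y) \<and>
     continuous_map T T (\<lambda>x. inv\<^bsub>G\<^esub> x) \<and>
     (\<forall>(U,\<phi>)\<in>A. \<forall>(V,\<psi>)\<in>A. \<forall>(W,\<omega>)\<in>A.
        smooth_on {(a,b). a \<in> \<phi> ` U \<and> b \<in> \<psi> ` V \<and> inv_into U \<phi> a \<otimes>\<^bsub>G\<^esub> inv_into V \<psi> b \<in> W}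
          (\<lambda>(a,b). \<omega> (inv_into U \<phi> a \<otimes>\<^bsub>G\<^esub> inv_into V \<psi> b))) \<and>
     (\<forall>(U,\<phi>)\<in>A. \<forall>(W,\<omega>)\<in>A.
        smooth_on {a. a \<in> \<phi> ` U \<and> inv\<^bsub>G\<^esub> (inv_into U \<phi> a) \<in> W}
          (\<lambda>a. \<omega> (inv\<^bsub>G\<^esub> (inv_into U \<phi> a))))"

definition one_parameter_subgroup ::
    "'g monoid \<Rightarrow> 'g topology \<Rightarrow> ('g, 'm::euclidean_space) atlas \<Rightarrow> (real \<Rightarrow> 'g) \<Rightarrow> bool" where
  "one_parameter_subgroup G T A \<gamma> \<longleftrightarrow>
     continuous_map euclideanreal T \<gamma> \<and>
     (\<forall>(U,\<phi>)\<in>A. smooth_on {t. \<gamma> t \<in> U} (\<lambda>t. \<phi> (\<gamma> t))) \<and>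
     (\<forall>s t. \<gamma> (s + t) = \<gamma> s \<otimes>\<^bsub>G\<^esub> \<gamma> t)"

(* Left-invariant vector field generated by \<xi>, as a derivation on functions on the group. *)

definition left_inv_field :: "'g monoid \<Rightarrow> ('m::real_vector \<Rightarrow> 'g) \<Rightarrow> 'm \<Rightarrow> ('g \<Rightarrow> real) \<Rightarrow> 'g \<Rightarrow> real" where
  "left_inv_field G ex \<xi> f g = deriv (\<lambda>t. f (g \<otimes>\<^bsub>G\<^esub> ex (t *\<^sub>R \<xi>))) 0"

(* The vector space 'm with the bracket br is the Lie algebra (of left-invariant vector fields) of the
   group, and ex is its exponential map. The charts also take values in 'm, so that dim G = DIM('m);
   the inner product of 'm plays no role. *)

definition lie_algebra_of ::
    "'g monoid \<Rightarrow> 'g topology \<Rightarrow> ('g, 'm::euclidean_space) atlas \<Rightarrow> ('m \<Rightarrow> 'g) \<Rightarrow> ('m \<Rightarrow> 'm \<Rightarrow> 'm) \<Rightarrow> bool" where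
  "lie_algebra_of G T A ex br \<longleftrightarrow>
     lie_group G T A \<and>
     (\<forall>\<xi>. one_parameter_subgroup G T A (\<lambda>t. ex (t *\<^sub>R \<xi>))) \<and>
     (\<forall>\<gamma>. one_parameter_subgroup G T A \<gamma> \<longrightarrow> (\<exists>!\<xi>. \<forall>t. \<gamma> t = ex (t *\<^sub>R \<xi>))) \<and>
     (\<forall>f. smooth_fun A f \<longrightarrow> (\<forall>g\<in>carrier G. \<forall>\<xi> \<eta>.
        (\<forall>a b. left_inv_field G ex (a *\<^sub>R \<xi> + b *\<^sub>R \<eta>) f g =
           a * left_inv_field G ex \<xi> f g + b * left_inv_field G ex \<eta> f g) \<and>
        left_inv_field G ex (br \<xi> \<eta>) f g =
          left_inv_field G ex \<xi> (left_inv_field G ex \<eta> f) g -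
          left_inv_field G ex \<eta> (left_inv_field G ex \<xi> f) g))"

definition lie_group_rep ::
    "'g monoid \<Rightarrow> ('g, 'm::euclidean_space) atlas \<Rightarrow> ('g \<Rightarrow> 'x::euclidean_space \<Rightarrow> 'x) \<Rightarrow> bool" where
  "lie_group_rep G A \<Phi> \<longleftrightarrow>
     (\<forall>g\<in>carrier G. linear (\<Phi> g)) \<and> \<Phi> \<one>\<^bsub>G\<^esub> = id \<and>
     (\<forall>g\<in>carrier G. \<forall>h\<in>carrier G. \<Phi> (g \<otimes>\<^bsub>G\<^esub> h) = \<Phi> g \<circ> \<Phi> h) \<and>
     (\<forall>x. smooth_fun A (\<lambda>g. \<Phi> g x))"


(* X = 'x, X* = ('x =>L real), Lie algebra s = 's with n = DIM('s), rotor algebra h = real^'h.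
   basE and frame are the bases E_i and \<E>_i(\<Gamma>); codim is the number r. *)

record (overloaded) ('g, 's::euclidean_space, 'x::euclidean_space, 'h::finite) rotor_system =
  grp :: "'g monoid"
  grptop :: "'g topology"
  charts :: "('g, 's) atlas"
  lexp :: "'s \<Rightarrow> 'g"
  brk :: "'s \<Rightarrow> 's \<Rightarrow> 's"
  rep :: "'g \<Rightarrow> 'x \<Rightarrow> 'x"
  codim :: nat
  constr :: "('x \<Rightarrow>\<^sub>L real) \<Rightarrow> 's set"
  basE :: "nat \<Rightarrow> 's"
  frame :: "('x \<Rightarrow>\<^sub>L real) \<Rightarrow> nat \<Rightarrow> 's"
  basX :: "nat \<Rightarrow> 'x"
  pot :: "('x \<Rightarrow>\<^sub>L real) \<Rightarrow> real"
  Gss :: "nat \<Rightarrow> nat \<Rightarrow> real"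
  Gsr :: "nat \<Rightarrow> 'h \<Rightarrow> real"
  Grr :: "real^'h^'h"

definition greek :: "('g, 's::euclidean_space, 'x::euclidean_space, 'h::finite) rotor_system \<Rightarrow> nat set" where
  "greek S = {1..DIM('s) - codim S}"

definition rotor_setting :: "('g, 's::euclidean_space, 'x::euclidean_space, 'h::finite) rotor_system \<Rightarrow> bool" where
  "rotor_setting S \<longleftrightarrow>
     lie_algebra_of (grp S) (grptop S) (charts S) (lexp S) (brk S) \<and>
     lie_group_rep (grp S) (charts S) (rep S) \<and>
     is_basis DIM('s) (basE S) \<and> is_basis DIM('x) (basX S) \<and>
     codim S \<le> DIM('s) \<and>
     (\<forall>\<Gamma>. subspace (constr S \<Gamma>) \<and> dim (constr S \<Gamma>) + codim S = DIM('s)) \<and>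
     (\<forall>\<Gamma>. is_basis DIM('s) (frame S \<Gamma>)) \<and>
     (\<forall>i\<in>{1..DIM('s)}. smooth_on UNIV (\<lambda>\<Gamma>. frame S \<Gamma> i)) \<and>
     (\<forall>\<Gamma>. constr S \<Gamma> = span (frame S \<Gamma> ` greek S)) \<and>
     smooth_on UNIV (pot S) \<and>
     (\<forall>i\<in>{1..DIM('s)}. \<forall>j\<in>{1..DIM('s)}. Gss S i j = Gss S j i) \<and>
     transpose (Grr S) = Grr S \<and> invertible (Grr S)"


(* \<xi>x and \<xi>\<gamma> *)

definition inf_act :: "('g, 's::euclidean_space, 'x::euclidean_space, 'h::finite) rotor_system \<Rightarrow> 's \<Rightarrow> 'x \<Rightarrow> 'x" where
  "inf_act S \<xi> x = vector_derivative (\<lambda>\<epsilon>. rep S (lexp S (\<epsilon> *\<^sub>R \<xi>)) x) (at 0)"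

definition inf_coact ::
    "('g, 's::euclidean_space, 'x::euclidean_space, 'h::finite) rotor_system \<Rightarrow> 's \<Rightarrow> ('x \<Rightarrow>\<^sub>L real) \<Rightarrow> 'x \<Rightarrow>\<^sub>L real" where
  "inf_coact S \<xi> \<gamma> = Blinfun (\<lambda>x. - \<gamma> (inf_act S \<xi> x))"

definition Kmap ::
    "('g, 's::euclidean_space, 'x::euclidean_space, 'h::finite) rotor_system \<Rightarrow> 'x \<Rightarrow> ('x \<Rightarrow>\<^sub>L real) \<Rightarrow> 's \<Rightarrow>\<^sub>L real" where
  "Kmap S x \<Gamma> = Blinfun (\<lambda>\<xi>. \<Gamma> (inf_act S \<xi> x))"

definition dualX ::
    "('g, 's::euclidean_space, 'x::euclidean_space, 'h::finite) rotor_system \<Rightarrow> nat \<Rightarrow> 'x \<Rightarrow>\<^sub>L real" where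
  "dualX S i = Blinfun (\<lambda>x. coord DIM('x) (basX S) x i)"

(* components \<Gamma>_i of \<Gamma> in the dual basis *)
definition covcomp ::
    "('g, 's::euclidean_space, 'x::euclidean_space, 'h::finite) rotor_system \<Rightarrow> ('x \<Rightarrow>\<^sub>L real) \<Rightarrow> nat \<Rightarrow> real" where
  "covcomp S \<Gamma> i = \<Gamma> (basX S i)"

(* partial derivative with respect to \<Gamma>_j *)
definition dGam ::
    "('g, 's::euclidean_space, 'x::euclidean_space, 'h::finite) rotor_system \<Rightarrow> nat \<Rightarrow>
      (('x \<Rightarrow>\<^sub>L real) \<Rightarrow> real) \<Rightarrow> ('x \<Rightarrow>\<^sub>L real) \<Rightarrow> real" where
  "dGam S j f \<Gamma> = frechet_derivative f (at \<Gamma>) (dualX S j)"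

(* Index convention below: upper indices first, then lower ones from left to right;
   frameE S l i \<Gamma> is \<E>^l_i and frameEinv S i l \<Gamma> is (\<E>^-1)^i_l. *)

definition frameE ::
    "('g, 's::euclidean_space, 'x::euclidean_space, 'h::finite) rotor_system \<Rightarrow> nat \<Rightarrow> nat \<Rightarrow> ('x \<Rightarrow>\<^sub>L real) \<Rightarrow> real" where
  "frameE S l i \<Gamma> = coord DIM('s) (basE S) (frame S \<Gamma> i) l"

definition frameEinv ::
    "('g, 's::euclidean_space, 'x::euclidean_space, 'h::finite) rotor_system \<Rightarrow> nat \<Rightarrow> nat \<Rightarrow> ('x \<Rightarrow>\<^sub>L real) \<Rightarrow> real" where
  "frameEinv S i l \<Gamma> = coord DIM('s) (frame S \<Gamma>) (basE S l) i"

definition structC ::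
    "('g, 's::euclidean_space, 'x::euclidean_space, 'h::finite) rotor_system \<Rightarrow>
      nat \<Rightarrow> nat \<Rightarrow> nat \<Rightarrow> ('x \<Rightarrow>\<^sub>L real) \<Rightarrow> real" where
  "structC S k i j \<Gamma> = coord DIM('s) (frame S \<Gamma>) (brk S (frame S \<Gamma> i) (frame S \<Gamma> j)) k"

(* \<kappa>^k_ij is the i-th component of E_j e_*^k *)
definition kappa ::
    "('g, 's::euclidean_space, 'x::euclidean_space, 'h::finite) rotor_system \<Rightarrow> nat \<Rightarrow> nat \<Rightarrow> nat \<Rightarrow> real" where
  "kappa S k i j = covcomp S (inf_coact S (basE S j) (dualX S k)) i"

definition varkappa ::
    "('g, 's::euclidean_space, 'x::euclidean_space, 'h::finite) rotor_system \<Rightarrow>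
      nat \<Rightarrow> nat \<Rightarrow> nat \<Rightarrow> ('x \<Rightarrow>\<^sub>L real) \<Rightarrow> real" where
  "varkappa S k i \<beta> \<Gamma> = (\<Sum>j=1..DIM('s). kappa S k i j * frameE S j \<beta> \<Gamma>)"

definition calK ::
    "('g, 's::euclidean_space, 'x::euclidean_space, 'h::finite) rotor_system \<Rightarrow>
      nat \<Rightarrow> nat \<Rightarrow> nat \<Rightarrow> ('x \<Rightarrow>\<^sub>L real) \<Rightarrow> real" where
  "calK S k i j \<Gamma> = Kmap S (basX S j) (dualX S k) (frame S \<Gamma> i)"

definition calF ::
    "('g, 's::euclidean_space, 'x::euclidean_space, 'h::finite) rotor_system \<Rightarrow>
      nat \<Rightarrow> nat \<Rightarrow> nat \<Rightarrow> ('x \<Rightarrow>\<^sub>L real) \<Rightarrow> real" where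
  "calF S i \<alpha> \<beta> \<Gamma> = (\<Sum>l=1..DIM('s). \<Sum>j=1..DIM('x). \<Sum>k=1..DIM('x).
     dGam S j (frameE S l \<alpha>) \<Gamma> * frameEinv S i l \<Gamma> * varkappa S k j \<beta> \<Gamma> * covcomp S \<Gamma> k)"

definition calB ::
    "('g, 's::euclidean_space, 'x::euclidean_space, 'h::finite) rotor_system \<Rightarrow>
      nat \<Rightarrow> nat \<Rightarrow> nat \<Rightarrow> ('x \<Rightarrow>\<^sub>L real) \<Rightarrow> real" where
  "calB S i \<alpha> \<beta> \<Gamma> = structC S i \<alpha> \<beta> \<Gamma> + calF S i \<alpha> \<beta> \<Gamma>"


definition kin ::
    "('g, 's::euclidean_space, 'x::euclidean_space, 'h::finite) rotor_system \<Rightarrow> 's \<Rightarrow> real^'h \<Rightarrow> real" where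
  "kin S \<xi> \<theta>' = (let x = coord DIM('s) (basE S) \<xi> in
     1/2 * (\<Sum>i=1..DIM('s). \<Sum>j=1..DIM('s). Gss S i j * x i * x j)
     + (\<Sum>i=1..DIM('s). \<Sum>a\<in>UNIV. Gsr S i a * x i * \<theta>' $ a)
     + 1/2 * (\<Sum>a\<in>UNIV. \<Sum>b\<in>UNIV. Grr S $ a $ b * \<theta>' $ a * \<theta>' $ b))"

definition lagr ::
    "('g, 's::euclidean_space, 'x::euclidean_space, 'h::finite) rotor_system \<Rightarrow>
      's \<Rightarrow> real^'h \<Rightarrow> ('x \<Rightarrow>\<^sub>L real) \<Rightarrow> real" where
  "lagr S \<xi> \<theta>' \<Gamma> = kin S \<xi> \<theta>' - pot S \<Gamma>"

definition ctrl_kin ::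
    "('g, 's::euclidean_space, 'x::euclidean_space, 'h::finite) rotor_system \<Rightarrow>
      ('h \<Rightarrow> nat \<Rightarrow> real) \<Rightarrow> real^'h^'h \<Rightarrow> real^'h^'h \<Rightarrow> 's \<Rightarrow> real^'h \<Rightarrow> real" where
  "ctrl_kin S \<tau> \<sigma> \<rho> \<xi> \<theta>' = (let x = coord DIM('s) (basE S) \<xi>;
       w = (\<lambda>a. \<theta>' $ a + (\<Sum>i=1..DIM('s).
              ((\<Sum>c\<in>UNIV. matrix_inv (Grr S) $ a $ c * Gsr S i c) + \<tau> a i) * x i)) in
     kin S \<xi> (\<chi> a. \<theta>' $ a + (\<Sum>i=1..DIM('s). \<tau> a i * x i))
     + 1/2 * (\<Sum>a\<in>UNIV. \<Sum>b\<in>UNIV. \<Sum>i=1..DIM('s). \<Sum>j=1..DIM('s).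
                \<sigma> $ a $ b * \<tau> a i * \<tau> b j * x i * x j)
     + 1/2 * (\<Sum>a\<in>UNIV. \<Sum>b\<in>UNIV. (\<rho> $ a $ b - Grr S $ a $ b) * w a * w b))"

definition ctrl_lagr ::
    "('g, 's::euclidean_space, 'x::euclidean_space, 'h::finite) rotor_system \<Rightarrow>
      ('h \<Rightarrow> nat \<Rightarrow> real) \<Rightarrow> real^'h^'h \<Rightarrow> real^'h^'h \<Rightarrow>
      's \<Rightarrow> real^'h \<Rightarrow> ('x \<Rightarrow>\<^sub>L real) \<Rightarrow> real" where
  "ctrl_lagr S \<tau> \<sigma> \<rho> \<xi> \<theta>' \<Gamma> = ctrl_kin S \<tau> \<sigma> \<rho> \<xi> \<theta>' - pot S \<Gamma>"


(* the element v^\<alpha> \<E>_\<alpha>(\<Gamma>) of the constraint subspace *)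
definition xi_c ::
    "('g, 's::euclidean_space, 'x::euclidean_space, 'h::finite) rotor_system \<Rightarrow>
      (nat \<Rightarrow> real) \<Rightarrow> ('x \<Rightarrow>\<^sub>L real) \<Rightarrow> 's" where
  "xi_c S v \<Gamma> = (\<Sum>\<alpha>\<in>greek S. v \<alpha> *\<^sub>R frame S \<Gamma> \<alpha>)"

(* p_i and \<pi>_a for a Lagrangian L; the constraint is imposed after differentiation *)

definition mom ::
    "('g, 's::euclidean_space, 'x::euclidean_space, 'h::finite) rotor_system \<Rightarrow>
      ('s \<Rightarrow> real^'h \<Rightarrow> ('x \<Rightarrow>\<^sub>L real) \<Rightarrow> real) \<Rightarrow>
      nat \<Rightarrow> (nat \<Rightarrow> real) \<Rightarrow> real^'h \<Rightarrow> ('x \<Rightarrow>\<^sub>L real) \<Rightarrow> real" where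
  "mom S L i v \<theta>' \<Gamma> = frechet_derivative (\<lambda>\<xi>. L \<xi> \<theta>' \<Gamma>) (at (xi_c S v \<Gamma>)) (frame S \<Gamma> i)"

definition rotor_mom ::
    "('g, 's::euclidean_space, 'x::euclidean_space, 'h::finite) rotor_system \<Rightarrow>
      ('s \<Rightarrow> real^'h \<Rightarrow> ('x \<Rightarrow>\<^sub>L real) \<Rightarrow> real) \<Rightarrow>
      'h \<Rightarrow> (nat \<Rightarrow> real) \<Rightarrow> real^'h \<Rightarrow> ('x \<Rightarrow>\<^sub>L real) \<Rightarrow> real" where
  "rotor_mom S L a v \<theta>' \<Gamma> = frechet_derivative (\<lambda>\<theta>'. L (xi_c S v \<Gamma>) \<theta>' \<Gamma>) (at \<theta>') (axis a 1)"

(* The constrained Euler--Poincare equations for the Lagrangian L with rotor torques u, at time t.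
   The curve \<theta>' is the rotor velocity; v t \<alpha> is used for \<alpha> in greek S only. *)

definition euler_poincare ::
    "('g, 's::euclidean_space, 'x::euclidean_space, 'h::finite) rotor_system \<Rightarrow>
      ('s \<Rightarrow> real^'h \<Rightarrow> ('x \<Rightarrow>\<^sub>L real) \<Rightarrow> real) \<Rightarrow> ('h \<Rightarrow> real) \<Rightarrow>
      (real \<Rightarrow> nat \<Rightarrow> real) \<Rightarrow> (real \<Rightarrow> real^'h) \<Rightarrow> (real \<Rightarrow> 'x \<Rightarrow>\<^sub>L real) \<Rightarrow> real \<Rightarrow> bool" where
  "euler_poincare S L u v \<theta>' \<Gamma> t \<longleftrightarrow>
     (\<forall>\<alpha>\<in>greek S.
        ((\<lambda>s. mom S L \<alpha> (v s) (\<theta>' s) (\<Gamma> s)) has_real_derivative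
          - (\<Sum>i=1..DIM('s). \<Sum>\<beta>\<in>greek S.
               calB S i \<alpha> \<beta> (\<Gamma> t) * mom S L i (v t) (\<theta>' t) (\<Gamma> t) * v t \<beta>)
          - (\<Sum>j=1..DIM('x). \<Sum>k=1..DIM('x).
               calK S k \<alpha> j (\<Gamma> t) * dGam S j (pot S) (\<Gamma> t) * covcomp S (\<Gamma> t) k)) (at t)) \<and>
     (\<forall>a. ((\<lambda>s. rotor_mom S L a (v s) (\<theta>' s) (\<Gamma> s)) has_real_derivative u a) (at t)) \<and>
     (\<forall>i\<in>{1..DIM('x)}.
        ((\<lambda>s. covcomp S (\<Gamma> s) i) has_real_derivative
          - (\<Sum>k=1..DIM('x). \<Sum>\<beta>\<in>greek S.
               varkappa S k i \<beta> (\<Gamma> t) * v t \<beta> * covcomp S (\<Gamma> t) k)) (at t))"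

definition calT ::
    "('g, 's::euclidean_space, 'x::euclidean_space, 'h::finite) rotor_system \<Rightarrow>
      ('h \<Rightarrow> nat \<Rightarrow> real) \<Rightarrow> 'h \<Rightarrow> nat \<Rightarrow> ('x \<Rightarrow>\<^sub>L real) \<Rightarrow> real" where
  "calT S \<tau> a i \<Gamma> = (\<Sum>j=1..DIM('s). \<tau> a j * frameE S j i \<Gamma>)"

(* the argument v' stands for the time derivative of v *)
definition control_law ::
    "('g, 's::euclidean_space, 'x::euclidean_space, 'h::finite) rotor_system \<Rightarrow>
      ('h \<Rightarrow> nat \<Rightarrow> real) \<Rightarrow> (nat \<Rightarrow> real) \<Rightarrow> (nat \<Rightarrow> real) \<Rightarrow> ('x \<Rightarrow>\<^sub>L real) \<Rightarrow> 'h \<Rightarrow> real" where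
  "control_law S \<tau> v v' \<Gamma> a = (\<Sum>b\<in>UNIV. Grr S $ a $ b *
     ((\<Sum>i=1..DIM('s). \<Sum>\<alpha>\<in>greek S. \<Sum>\<beta>\<in>greek S.
         calT S \<tau> b i \<Gamma> * calF S i \<alpha> \<beta> \<Gamma> * v \<alpha> * v \<beta>)
      - (\<Sum>\<alpha>\<in>greek S. calT S \<tau> b \<alpha> \<Gamma> * v' \<alpha>)))"

end

theory Submission
  imports Defs
begin

text \<open>Let \<open>c\<close> be the vector \<open>G\<^sub>a\<^sub>i \<xi>\<^sup>i\<close>, so that \<open>\<tau> \<xi> = - \<sigma>\<inverse> c\<close>. Completing squares, the matching
  conditions turn the controlled kinetic energy into the original one with \<open>G\<^sub>a\<^sub>b\<close> replaced by
  \<open>\<rho>\<^sub>a\<^sub>b\<close>. Hence the momenta \<open>p\<^sub>i\<close> of both Lagrangians agree identically, and the rotor momenta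
  are \<open>c + G \<theta>'\<close> and \<open>c + \<rho> \<theta>'\<close>. Along solutions of the equation for \<open>\<Gamma>\<close>, the control law is
  \<open>- G (\<tau> \<xi>)\<cdot> = G \<sigma>\<inverse> c\<cdot>\<close> (the dot being the time derivative), and since
  \<open>G \<sigma>\<inverse> = 1 - G \<rho>\<inverse>\<close>, both rotor equations say \<open>\<theta>'\<cdot> = - \<rho>\<inverse> c\<cdot>\<close>.\<close>

text \<open>Keeps the lower bound of the index ranges \<open>{1..n}\<close> from becoming
  \<open>Suc 0\<close>, so that sums written with \<open>1\<close> still match after
  simplification.\<close>

declare One_nat_def [simp del]

section \<open>Coordinates in a basis and components of covectors\<close>

lemma linear_coord: "is_basis n B \<Longrightarrow> linear (\<lambda>x. coord n B x i)"
  unfolding coord_def is_basis_def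
  by (intro linearI) (auto simp: real_vector.representation_add real_vector.representation_scale)

lemma coord_basis:
  assumes "is_basis n B" "i \<in> {1..n}" "j \<in> {1..n}"
  shows "coord n B (B i) j = (if i = j then 1 else 0)"
proof -
  have "inj_on B {1..n}" "independent (B ` {1..n})"
    using assms(1) by (simp_all add: is_basis_def)
  then show ?thesis
    using assms(2,3) by (simp add: coord_def real_vector.representation_basis inj_on_eq_iff)
qed

lemma coord_expansion:
  assumes "is_basis n B"
  shows "x = (\<Sum>i=1..n. coord n B x i *\<^sub>R B i)"
proof -
  have B: "inj_on B {1..n}" "independent (B ` {1..n})" "span (B ` {1..n}) = UNIV"
    using assms by (auto simp: is_basis_def)
  have "(\<Sum>b\<in>B ` {1..n}. representation (B ` {1..n}) x b *\<^sub>R b) = x"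
    by (rule real_vector.sum_representation_eq) (use B in auto)
  then show ?thesis
    unfolding coord_def using B(1) by (simp add: sum.reindex)
qed

text \<open>Evaluate at \<open>x\<close>, expand \<open>x\<close> in \<open>basX S\<close> and use
  linearity. This later turns a Frechet derivative along a covector into a sum of the partial
  derivatives \<open>dGam\<close>.\<close>

lemma blinfun_dual_expansion:
  fixes S :: "('g, 's::euclidean_space, 'x::euclidean_space, 'h::finite) rotor_system"
  assumes "is_basis DIM('x) (basX S)"
  shows "\<gamma> = (\<Sum>i=1..DIM('x). covcomp S \<gamma> i *\<^sub>R dualX S i)"
proof (rule blinfun_eqI)
  fix x
  have dual: "dualX S i x = coord DIM('x) (basX S) x i" for i
    unfolding dualX_def using linear_coord[OF assms, of i]
    by (simp add: bounded_linear_Blinfun_apply linear_conv_bounded_linear)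
  have "\<gamma> x = \<gamma> (\<Sum>i=1..DIM('x). coord DIM('x) (basX S) x i *\<^sub>R basX S i)"
    using coord_expansion[OF assms, of x] by simp
  then show "\<gamma> x = (\<Sum>i=1..DIM('x). covcomp S \<gamma> i *\<^sub>R dualX S i) x"
    by (simp add: blinfun.sum_right blinfun.sum_left blinfun.scaleR_right blinfun.scaleR_left
        dual covcomp_def mult.commute)
qed

section \<open>Derivatives and quadratic forms\<close>

lemma smooth_on_differentiable: "smooth_on A f \<Longrightarrow> x \<in> A \<Longrightarrow> f differentiable (at x)"
  unfolding smooth_on_def by (drule spec[of _ "Suc 0"]) simp

text \<open>\<open>frechet_derivative\<close> is a choice among all \<open>D\<close> with
  \<open>has_derivative\<close>, and adding a constant leaves this set of candidates unchanged.
  Hence differentiability need not be assumed.\<close>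

lemma frechet_derivative_plus_const:
  "frechet_derivative (\<lambda>x. f x + c) F = frechet_derivative f F"
proof -
  have "((\<lambda>x. f x + c) has_derivative D) F \<longleftrightarrow> (f has_derivative D) F" for D
    using has_derivative_add_const[of "\<lambda>x. f x + c" D F "- c"] has_derivative_add_const[of f D F c]
    by auto
  then show ?thesis by (simp add: frechet_derivative_def)
qed

lemma symmetric_quadratic_add:
  fixes M :: "real^'n^'n"
  assumes "transpose M = M"
  shows "(x + y) \<bullet> (M *v (x + y)) = x \<bullet> (M *v x) + 2 * (x \<bullet> (M *v y)) + y \<bullet> (M *v y)"
proof -
  have "y \<bullet> (M *v x) = x \<bullet> (M *v y)"
    by (metis assms dot_lmul_matrix inner_commute vector_transpose_matrix)
  then show ?thesis
    by (simp add: matrix_vector_right_distrib inner_add_left inner_add_right)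
qed

lemma matrix_inv_vector:
  fixes M :: "real^'n^'n"
  assumes "invertible M"
  shows "matrix_inv M *v (M *v x) = x" "M *v (matrix_inv M *v x) = x"
proof -
  have "M ** matrix_inv M = mat 1 \<and> matrix_inv M ** M = mat 1"
    using assms unfolding invertible_def matrix_inv_def by (rule someI_ex)
  then show "matrix_inv M *v (M *v x) = x" "M *v (matrix_inv M *v x) = x"
    by (simp_all add: matrix_vector_mul_assoc)
qed

lemma has_derivative_linear_plus_quadratic:
  fixes M :: "real^'n^'n"
  assumes "transpose M = M"
  shows "((\<lambda>q. k + c \<bullet> q + 1/2 * (q \<bullet> (M *v q))) has_derivative (\<lambda>h. (c + M *v q) \<bullet> h)) (at q)"
proof -
  have M: "((\<lambda>q. M *v q) has_derivative (\<lambda>h. M *v h)) (at q)"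
    by (simp add: bounded_linear_imp_has_derivative)
  have "q \<bullet> (M *v h) = h \<bullet> (M *v q)" for h
    by (metis assms dot_lmul_matrix inner_commute vector_transpose_matrix)
  then have "(\<lambda>h. c \<bullet> h + 1/2 * (q \<bullet> (M *v h) + h \<bullet> (M *v q))) = (\<lambda>h. (c + M *v q) \<bullet> h)"
    by (simp add: inner_add_left inner_commute[of "M *v q"])
  moreover have "((\<lambda>q. k + c \<bullet> q + 1/2 * (q \<bullet> (M *v q))) has_derivative
      (\<lambda>h. c \<bullet> h + 1/2 * (q \<bullet> (M *v h) + h \<bullet> (M *v q)))) (at q)"
    by (auto intro!: derivative_eq_intros M)
  ultimately show ?thesis by simp
qed

text \<open>Allows the rotor equations, stated for each component, to be handled as one vector
  equation. For the converse, \<open>f\<close> is rebuilt from its components and the standard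
  basis.\<close>

lemma has_vector_derivative_vec_iff:
  fixes f :: "real \<Rightarrow> real^'n"
  shows "(f has_vector_derivative D) F \<longleftrightarrow> (\<forall>a. ((\<lambda>s. f s $ a) has_real_derivative D $ a) F)"
proof
  assume "(f has_vector_derivative D) F"
  then show "\<forall>a. ((\<lambda>s. f s $ a) has_real_derivative D $ a) F"
    unfolding has_real_derivative_iff_has_vector_derivative
    by (auto intro: bounded_linear.has_vector_derivative[OF bounded_linear_vec_nth])
next
  assume "\<forall>a. ((\<lambda>s. f s $ a) has_real_derivative D $ a) F"
  then have "((\<lambda>s. \<Sum>a\<in>UNIV. f s $ a *\<^sub>R axis a 1) has_vector_derivative
      (\<Sum>a\<in>UNIV. D $ a *\<^sub>R axis a (1::real))) F"
    unfolding has_real_derivative_iff_has_vector_derivative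
    by (auto intro!: has_vector_derivative_sum
        bounded_linear.has_vector_derivative[OF bounded_linear_scaleR_left])
  moreover have "(\<Sum>a\<in>UNIV. x $ a *\<^sub>R axis a (1::real)) = x" for x :: "real^'n"
    using basis_expansion[of x] by (simp add: scalar_mult_eq_scaleR)
  ultimately show "(f has_vector_derivative D) F" by simp
qed

section \<open>The kinetic energy in terms of the vector \<open>c\<close> of the overview, here
  \<open>rotor_coupling\<close>\<close>

definition rotor_coupling ::
    "('g, 's::euclidean_space, 'x::euclidean_space, 'h::finite) rotor_system \<Rightarrow> 's \<Rightarrow> real^'h" where
  "rotor_coupling S \<xi> = (\<chi> a. \<Sum>i=1..DIM('s). Gsr S i a * coord DIM('s) (basE S) \<xi> i)"

text \<open>The kinetic energy at rotor velocity zero. It is common to both Lagrangians, so it stays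
  unexpanded once they are in normal form.\<close>

definition locked_kin ::
    "('g, 's::euclidean_space, 'x::euclidean_space, 'h::finite) rotor_system \<Rightarrow> 's \<Rightarrow> real" where
  "locked_kin S \<xi> = (let x = coord DIM('s) (basE S) \<xi> in
     1/2 * (\<Sum>i=1..DIM('s). \<Sum>j=1..DIM('s). Gss S i j * x i * x j))"

lemma quadratic_form_sum:
  fixes M :: "real^'n^'n"
  shows "(\<Sum>a\<in>UNIV. \<Sum>b\<in>UNIV. M $ a $ b * q $ a * q $ b) = q \<bullet> (M *v q)"
  by (simp add: inner_vec_def matrix_vector_mult_def sum_distrib_left mult_ac)

lemma kin_eq: "kin S \<xi> q = locked_kin S \<xi> + rotor_coupling S \<xi> \<bullet> q + 1/2 * (q \<bullet> (Grr S *v q))"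
proof -
  have "(\<Sum>i\<in>A. \<Sum>a\<in>UNIV. Gsr S i a * x i * q $ a) = (\<chi> a. \<Sum>i\<in>A. Gsr S i a * x i) \<bullet> q" for A x
    by (subst sum.swap) (simp add: inner_vec_def sum_distrib_right)
  then show ?thesis
    by (simp add: kin_def locked_kin_def rotor_coupling_def quadratic_form_sum Let_def)
qed

text \<open>With \<open>M = matrix_inv \<sigma>\<close> the coefficients on the right are those of
  \<open>- \<tau>\<close>; with \<open>M = matrix_inv (Grr S)\<close> they are the ones that occur
  in \<open>ctrl_kin\<close>.\<close>

lemma matrix_vector_rotor_coupling:
  fixes S :: "('g, 's::euclidean_space, 'x::euclidean_space, 'h::finite) rotor_system"
  shows "(M *v rotor_coupling S \<xi>) $ a =
    (\<Sum>i=1..DIM('s). (\<Sum>b\<in>UNIV. M $ a $ b * Gsr S i b) * coord DIM('s) (basE S) \<xi> i)"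
  unfolding rotor_coupling_def matrix_vector_mult_def
  by (simp add: sum_distrib_left sum_distrib_right) (subst sum.swap, simp add: mult_ac)

section \<open>The matching conditions, and the resulting kinetic energies and momenta\<close>

locale matched_rotor_system =
  fixes S :: "('g, 's::euclidean_space, 'x::euclidean_space, 'h::finite) rotor_system"
    and \<tau> :: "'h \<Rightarrow> nat \<Rightarrow> real"
    and \<sigma> \<rho> :: "real^'h^'h"
  assumes setting: "rotor_setting S"
    and inv_sigma: "invertible \<sigma>"
    and sym_rho: "transpose \<rho> = \<rho>" and inv_rho: "invertible \<rho>"
    and tau: "\<forall>a. \<forall>i\<in>{1..DIM('s)}. \<tau> a i = - (\<Sum>b\<in>UNIV. matrix_inv \<sigma> $ a $ b * Gsr S i b)"
    and matching: "matrix_inv \<sigma> + matrix_inv \<rho> = matrix_inv (Grr S)"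
begin

lemma sym_G: "transpose (Grr S) = Grr S" and inv_G: "invertible (Grr S)"
  and basis_E: "is_basis DIM('s) (basE S)" and basis_X: "is_basis DIM('x) (basX S)"
  and basis_frame: "is_basis DIM('s) (frame S \<gamma>)"
  and smooth_frame: "i \<in> {1..DIM('s)} \<Longrightarrow> smooth_on UNIV (\<lambda>\<gamma>. frame S \<gamma> i)"
  using setting by (auto simp: rotor_setting_def)

lemma matching_vector: "matrix_inv \<sigma> *v x + matrix_inv \<rho> *v x = matrix_inv (Grr S) *v x"
  by (simp flip: matching matrix_vector_mult_add_rdistrib)

lemma tau_coupling:
  "(\<Sum>i=1..DIM('s). \<tau> a i * coord DIM('s) (basE S) \<xi> i)
    = - (matrix_inv \<sigma> *v rotor_coupling S \<xi>) $ a"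
  unfolding matrix_vector_rotor_coupling using tau by (simp add: sum_negf)

text \<open>The \<open>Grr S\<close> part of the form in \<open>w\<close> cancels all terms of the
  shifted kinetic energy in \<open>q + T\<close> except \<open>locked_kin S \<xi>\<close>, and the
  \<open>\<rho>\<close> part supplies the new terms in \<open>q\<close>. What remains is half the
  form of \<open>matrix_inv \<sigma> + matrix_inv \<rho> - matrix_inv (Grr S)\<close> at
  \<open>c\<close>, which vanishes by matching.\<close>

lemma ctrl_kin_eq:
  "ctrl_kin S \<tau> \<sigma> \<rho> \<xi> q = locked_kin S \<xi> + rotor_coupling S \<xi> \<bullet> q + 1/2 * (q \<bullet> (\<rho> *v q))"
proof -
  define c where "c = rotor_coupling S \<xi>"
  define x where "x = coord DIM('s) (basE S) \<xi>"
  \<comment> \<open>\<open>T\<close> is the vector \<open>\<tau> \<xi>\<close>, and \<open>w\<close>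
    is the argument of the form with matrix \<open>\<rho> - Grr S\<close> in
    \<open>ctrl_kin\<close>.\<close>
  define T where "T = - (matrix_inv \<sigma> *v c)"
  define w where "w = q + T + matrix_inv (Grr S) *v c"
  have T: "(\<Sum>i=1..DIM('s). \<tau> a i * x i) = T $ a" for a
    using tau_coupling[of a \<xi>] by (simp add: T_def c_def x_def)
  have w: "q $ a + (\<Sum>i=1..DIM('s). ((\<Sum>b\<in>UNIV. matrix_inv (Grr S) $ a $ b * Gsr S i b) + \<tau> a i) * x i)
      = w $ a" for a
    using matrix_vector_rotor_coupling[of "matrix_inv (Grr S)" S \<xi> a] T[of a]
    by (simp add: distrib_right sum.distrib w_def c_def x_def)
  have shift: "(\<chi> a. q $ a + T $ a) = q + T"
    by (simp add: vec_eq_iff)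
  have ss: "(\<Sum>a\<in>UNIV. \<Sum>b\<in>UNIV. \<Sum>i=1..DIM('s). \<Sum>j=1..DIM('s). \<sigma> $ a $ b * \<tau> a i * \<tau> b j * x i * x j)
      = T \<bullet> (\<sigma> *v T)"
  proof -
    have "T $ a * T $ b = (\<Sum>i=1..DIM('s). \<Sum>j=1..DIM('s). \<tau> a i * \<tau> b j * x i * x j)" for a b
      unfolding T[symmetric] sum_product by (simp add: mult_ac)
    then show ?thesis
      unfolding quadratic_form_sum[symmetric] by (simp add: sum_distrib_left mult.assoc)
  qed
  have rr: "(\<Sum>a\<in>UNIV. \<Sum>b\<in>UNIV. (\<rho> $ a $ b - Grr S $ a $ b) * w $ a * w $ b)
      = w \<bullet> (\<rho> *v w) - w \<bullet> (Grr S *v w)"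
    unfolding quadratic_form_sum[symmetric] by (simp add: left_diff_distrib sum_subtractf)
  have K: "ctrl_kin S \<tau> \<sigma> \<rho> \<xi> q = locked_kin S \<xi> + c \<bullet> (q + T)
      + 1/2 * ((q + T) \<bullet> (Grr S *v (q + T)))
      + 1/2 * (T \<bullet> (\<sigma> *v T)) + 1/2 * (w \<bullet> (\<rho> *v w) - w \<bullet> (Grr S *v w))"
    unfolding ctrl_kin_def kin_eq Let_def x_def[symmetric] T w shift ss rr c_def ..
  \<comment> \<open>By matching, \<open>- matrix_inv \<sigma> *v c + matrix_inv (Grr S) *v c\<close>
    is \<open>matrix_inv \<rho> *v c\<close>. So \<open>w\<close> has two splittings: this one suits
    the form of \<open>\<rho>\<close>, the definition suits that of \<open>Grr S\<close>.\<close>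
  have "w = q + matrix_inv \<rho> *v c"
    using matching_vector[of c] by (simp add: w_def T_def algebra_simps)
  then have wr: "w \<bullet> (\<rho> *v w) = q \<bullet> (\<rho> *v q) + 2 * (q \<bullet> c) + (matrix_inv \<rho> *v c) \<bullet> c"
    by (simp add: symmetric_quadratic_add[OF sym_rho] matrix_inv_vector[OF inv_rho])
  have wG: "w \<bullet> (Grr S *v w) = (q + T) \<bullet> (Grr S *v (q + T)) + 2 * ((q + T) \<bullet> c) + (matrix_inv (Grr S) *v c) \<bullet> c"
    unfolding w_def by (subst symmetric_quadratic_add[OF sym_G]) (simp add: matrix_inv_vector[OF inv_G])
  have TT: "T \<bullet> (\<sigma> *v T) = (matrix_inv \<sigma> *v c) \<bullet> c"
    by (simp add: T_def linear_neg[OF matrix_vector_mul_linear] matrix_inv_vector[OF inv_sigma])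
  show ?thesis
    unfolding K wr wG TT c_def[symmetric] matching_vector[of c, symmetric]
    by (simp add: inner_add_left inner_add_right inner_commute algebra_simps)
qed

text \<open>For fixed \<open>q\<close> and \<open>\<gamma>\<close> the two Lagrangians differ by a
  number independent of \<open>\<xi>\<close>, so their derivatives in \<xi> agree and need not be
  computed.\<close>

lemma mom_ctrl_lagr: "mom S (ctrl_lagr S \<tau> \<sigma> \<rho>) i u q \<gamma> = mom S (lagr S) i u q \<gamma>"
proof -
  have "(\<lambda>\<xi>. ctrl_lagr S \<tau> \<sigma> \<rho> \<xi> q \<gamma>)
      = (\<lambda>\<xi>. lagr S \<xi> q \<gamma> + (1/2 * (q \<bullet> (\<rho> *v q)) - 1/2 * (q \<bullet> (Grr S *v q))))"
    by (simp add: fun_eq_iff ctrl_lagr_def lagr_def ctrl_kin_eq kin_eq)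
  then show ?thesis
    by (simp only: mom_def frechet_derivative_plus_const)
qed

lemma rotor_mom_quadratic:
  assumes "\<And>q. L (xi_c S u \<gamma>) q \<gamma> = k + c \<bullet> q + 1/2 * (q \<bullet> (M *v q))" "transpose M = M"
  shows "rotor_mom S L a u q \<gamma> = (c + M *v q) $ a"
proof -
  have "((\<lambda>q. L (xi_c S u \<gamma>) q \<gamma>) has_derivative (\<lambda>h. (c + M *v q) \<bullet> h)) (at q)"
    unfolding assms(1) by (rule has_derivative_linear_plus_quadratic[OF assms(2)])
  then show ?thesis
    unfolding rotor_mom_def by (simp add: inner_axis flip: frechet_derivative_at)
qed

lemma rotor_mom_lagr:
  "rotor_mom S (lagr S) a u q \<gamma> = (rotor_coupling S (xi_c S u \<gamma>) + Grr S *v q) $ a"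
  by (rule rotor_mom_quadratic[where k = "locked_kin S (xi_c S u \<gamma>) - pot S \<gamma>"])
    (simp_all add: lagr_def kin_eq sym_G)

lemma rotor_mom_ctrl_lagr:
  "rotor_mom S (ctrl_lagr S \<tau> \<sigma> \<rho>) a u q \<gamma> = (rotor_coupling S (xi_c S u \<gamma>) + \<rho> *v q) $ a"
  by (rule rotor_mom_quadratic[where k = "locked_kin S (xi_c S u \<gamma>) - pot S \<gamma>"])
    (simp_all add: ctrl_lagr_def ctrl_kin_eq sym_rho)

section \<open>The time derivative of the constrained velocity, and the control law as a
  derivative\<close>

lemma coord_xi_c:
  "coord DIM('s) (basE S) (xi_c S u \<gamma>) l = (\<Sum>\<alpha>\<in>greek S. u \<alpha> * frameE S l \<alpha> \<gamma>)"
  by (simp add: xi_c_def linear_sum[OF linear_coord[OF basis_E]]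
      linear_cmul[OF linear_coord[OF basis_E]] frameE_def)

lemma frameE_frameEinv:
  assumes "l \<in> {1..DIM('s)}" "j \<in> {1..DIM('s)}"
  shows "(\<Sum>i=1..DIM('s). frameE S j i \<gamma> * frameEinv S i l \<gamma>) = (if l = j then 1 else 0)"
proof -
  have "coord DIM('s) (basE S) (basE S l) j
      = coord DIM('s) (basE S) (\<Sum>i=1..DIM('s). frameEinv S i l \<gamma> *\<^sub>R frame S \<gamma> i) j"
    unfolding frameEinv_def using coord_expansion[OF basis_frame, of "basE S l" \<gamma>] by simp
  also have "\<dots> = (\<Sum>i=1..DIM('s). frameE S j i \<gamma> * frameEinv S i l \<gamma>)"
    by (simp add: linear_sum[OF linear_coord[OF basis_E]]
        linear_cmul[OF linear_coord[OF basis_E]] frameE_def mult.commute)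
  finally show ?thesis using coord_basis[OF basis_E assms] by simp
qed

text \<open>Passing from the fixed basis to the frame and back recovers \<tau>. This removes the
  factor \<open>frameEinv\<close> of \<open>calF\<close> from the control law.\<close>

lemma calT_frameEinv:
  assumes "l \<in> {1..DIM('s)}"
  shows "(\<Sum>i=1..DIM('s). calT S \<tau> b i \<gamma> * frameEinv S i l \<gamma>) = \<tau> b l"
proof -
  have "(\<Sum>i=1..DIM('s). calT S \<tau> b i \<gamma> * frameEinv S i l \<gamma>)
      = (\<Sum>j=1..DIM('s). \<tau> b j * (\<Sum>i=1..DIM('s). frameE S j i \<gamma> * frameEinv S i l \<gamma>))"
    unfolding calT_def sum_distrib_left sum_distrib_right
    by (subst sum.swap) (simp add: mult_ac)
  also have "\<dots> = (\<Sum>j=1..DIM('s). \<tau> b j * (if l = j then 1 else 0))"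
    using assms by (intro sum.cong refl) (simp add: frameE_frameEinv)
  also have "\<dots> = (\<Sum>j=1..DIM('s). if l = j then \<tau> b j else 0)"
    by (intro sum.cong) simp_all
  finally show ?thesis using assms by simp
qed

lemma frameE_has_real_derivative:
  assumes \<Gamma>: "(\<Gamma> has_vector_derivative \<Gamma>') (at t)" and i: "i \<in> {1..DIM('s)}"
  shows "((\<lambda>s. frameE S l i (\<Gamma> s)) has_real_derivative
    (\<Sum>j=1..DIM('x). dGam S j (frameE S l i) (\<Gamma> t) * covcomp S \<Gamma>' j)) (at t)"
proof -
  have "bounded_linear (\<lambda>x. coord DIM('s) (basE S) x l)"
    using linear_coord[OF basis_E] by (simp add: linear_conv_bounded_linear)
  then have "(\<lambda>\<gamma>. coord DIM('s) (basE S) (frame S \<gamma> i) l) differentiable (at (\<Gamma> t))"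
    using smooth_on_differentiable[OF smooth_frame[OF i], of "\<Gamma> t"]
    by (auto simp: differentiable_def dest: bounded_linear.has_derivative)
  then have D: "(frameE S l i has_derivative frechet_derivative (frameE S l i) (at (\<Gamma> t))) (at (\<Gamma> t))"
    by (simp add: frechet_derivative_works[symmetric] frameE_def[abs_def])
  then have lin: "linear (frechet_derivative (frameE S l i) (at (\<Gamma> t)))"
    by (rule has_derivative_linear)
  have "((\<lambda>s. frameE S l i (\<Gamma> s)) has_vector_derivative
      frechet_derivative (frameE S l i) (at (\<Gamma> t)) \<Gamma>') (at t)"
    using vector_derivative_diff_chain_within[OF \<Gamma> has_derivative_at_withinI[OF D]]
    by (simp add: o_def)
  \<comment> \<open>The chain rule gives the derivative along \<open>\<Gamma>'\<close>; expanding
    \<open>\<Gamma>'\<close> in the dual basis produces the partial derivatives.\<close>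
  also have "frechet_derivative (frameE S l i) (at (\<Gamma> t)) \<Gamma>'
      = frechet_derivative (frameE S l i) (at (\<Gamma> t)) (\<Sum>j=1..DIM('x). covcomp S \<Gamma>' j *\<^sub>R dualX S j)"
    by (subst blinfun_dual_expansion[OF basis_X, of \<Gamma>']) simp
  also have "\<dots> = (\<Sum>j=1..DIM('x). dGam S j (frameE S l i) (\<Gamma> t) * covcomp S \<Gamma>' j)"
    by (simp add: linear_sum[OF lin] linear_cmul[OF lin] dGam_def mult.commute)
  finally show ?thesis by (simp add: has_real_derivative_iff_has_vector_derivative)
qed

text \<open>The time derivative of the fixed-basis components of \<open>\<xi> = v\<^sup>\<alpha> \<E>\<^sub>\<alpha>(\<Gamma>)\<close>.\<close>

definition coord_rate where
  "coord_rate u u' \<gamma> \<gamma>' l = (\<Sum>\<alpha>\<in>greek S. u' \<alpha> * frameE S l \<alpha> \<gamma> +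
     u \<alpha> * (\<Sum>j=1..DIM('x). dGam S j (frameE S l \<alpha>) \<gamma> * covcomp S \<gamma>' j))"

lemma coord_xi_c_has_real_derivative:
  assumes "\<And>\<alpha>. \<alpha> \<in> greek S \<Longrightarrow> ((\<lambda>s. v s \<alpha>) has_real_derivative v' \<alpha>) (at t)"
    and "(\<Gamma> has_vector_derivative \<Gamma>') (at t)"
  shows "((\<lambda>s. coord DIM('s) (basE S) (xi_c S (v s) (\<Gamma> s)) l) has_real_derivative
    coord_rate (v t) v' (\<Gamma> t) \<Gamma>' l) (at t)"
proof -
  have "\<alpha> \<in> {1..DIM('s)}" if "\<alpha> \<in> greek S" for \<alpha>
    using that by (auto simp: greek_def)
  then show ?thesis
    unfolding coord_xi_c coord_rate_def
    by (auto intro!: derivative_eq_intros assms frameE_has_real_derivative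
        simp: mult.commute add.commute)
qed

text \<open>The assumption is the equation for \<Gamma>. It turns the \<open>calF\<close> term into
  minus \<tau> applied to the part of \<open>coord_rate\<close> that comes from the moving frame,
  while the \<open>u'\<close> term is the rest. So the law is \<open>- Grr S\<close> applied to the
  rate of \<open>\<tau> \<xi>\<close>.\<close>

lemma control_law_eq:
  assumes "\<And>j. j \<in> {1..DIM('x)} \<Longrightarrow> covcomp S \<gamma>' j =
    - (\<Sum>k=1..DIM('x). \<Sum>\<beta>\<in>greek S. varkappa S k j \<beta> \<gamma> * u \<beta> * covcomp S \<gamma> k)"
  shows "control_law S \<tau> u u' \<gamma> a
    = - (\<Sum>b\<in>UNIV. Grr S $ a $ b * (\<Sum>l=1..DIM('s). \<tau> b l * coord_rate u u' \<gamma> \<gamma>' l))"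
proof -
  \<comment> \<open>Contracting \<open>calT\<close> with \<open>frameEinv\<close> leaves \<tau>, and
    summing the \<open>varkappa\<close> terms over \<beta> and \<open>k\<close> gives minus the
    components of \<open>\<gamma>'\<close>.\<close>
  have F: "(\<Sum>\<beta>\<in>greek S. \<Sum>i=1..DIM('s). calT S \<tau> b i \<gamma> * calF S i \<alpha> \<beta> \<gamma> * u \<beta>)
      = - (\<Sum>l=1..DIM('s). \<tau> b l * (\<Sum>j=1..DIM('x). dGam S j (frameE S l \<alpha>) \<gamma> * covcomp S \<gamma>' j))"
    for b \<alpha>
  proof -
    have "(\<Sum>i=1..DIM('s). calT S \<tau> b i \<gamma> * calF S i \<alpha> \<beta> \<gamma> * u \<beta>) =
        (\<Sum>i=1..DIM('s). \<Sum>l=1..DIM('s). calT S \<tau> b i \<gamma> * frameEinv S i l \<gamma> *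
          (\<Sum>j=1..DIM('x). dGam S j (frameE S l \<alpha>) \<gamma> *
            (\<Sum>k=1..DIM('x). varkappa S k j \<beta> \<gamma> * u \<beta> * covcomp S \<gamma> k)))" for \<beta>
      by (simp add: calF_def sum_distrib_left sum_distrib_right mult_ac)
    also have "\<dots> \<beta> = (\<Sum>l=1..DIM('s). (\<Sum>i=1..DIM('s). calT S \<tau> b i \<gamma> * frameEinv S i l \<gamma>) *
          (\<Sum>j=1..DIM('x). dGam S j (frameE S l \<alpha>) \<gamma> *
            (\<Sum>k=1..DIM('x). varkappa S k j \<beta> \<gamma> * u \<beta> * covcomp S \<gamma> k)))" for \<beta>
      by (subst sum.swap) (simp add: sum_distrib_right)
    also have "\<dots> \<beta> = (\<Sum>l=1..DIM('s). \<tau> b l *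
          (\<Sum>j=1..DIM('x). dGam S j (frameE S l \<alpha>) \<gamma> *
            (\<Sum>k=1..DIM('x). varkappa S k j \<beta> \<gamma> * u \<beta> * covcomp S \<gamma> k)))" for \<beta>
      by (intro sum.cong refl) (simp add: calT_frameEinv)
    finally have "(\<Sum>\<beta>\<in>greek S. \<Sum>i=1..DIM('s). calT S \<tau> b i \<gamma> * calF S i \<alpha> \<beta> \<gamma> * u \<beta>)
      = (\<Sum>\<beta>\<in>greek S. \<Sum>l=1..DIM('s). \<tau> b l *
          (\<Sum>j=1..DIM('x). dGam S j (frameE S l \<alpha>) \<gamma> *
            (\<Sum>k=1..DIM('x). varkappa S k j \<beta> \<gamma> * u \<beta> * covcomp S \<gamma> k)))"
      by simp
    also have "\<dots> = (\<Sum>l=1..DIM('s). \<tau> b l *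
          (\<Sum>j=1..DIM('x). dGam S j (frameE S l \<alpha>) \<gamma> *
            (\<Sum>k=1..DIM('x). \<Sum>\<beta>\<in>greek S. varkappa S k j \<beta> \<gamma> * u \<beta> * covcomp S \<gamma> k)))"
      by (simp add: sum_distrib_left sum.swap[of _ _ "greek S"])
    finally show ?thesis
      using assms by (simp add: sum_negf)
  qed
  have inner: "(\<Sum>i=1..DIM('s). \<Sum>\<alpha>\<in>greek S. \<Sum>\<beta>\<in>greek S.
         calT S \<tau> b i \<gamma> * calF S i \<alpha> \<beta> \<gamma> * u \<alpha> * u \<beta>) - (\<Sum>\<alpha>\<in>greek S. calT S \<tau> b \<alpha> \<gamma> * u' \<alpha>)
      = - (\<Sum>l=1..DIM('s). \<tau> b l * coord_rate u u' \<gamma> \<gamma>' l)" for b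
  proof -
    have "(\<Sum>i=1..DIM('s). \<Sum>\<alpha>\<in>greek S. \<Sum>\<beta>\<in>greek S. calT S \<tau> b i \<gamma> * calF S i \<alpha> \<beta> \<gamma> * u \<alpha> * u \<beta>)
        = (\<Sum>\<alpha>\<in>greek S. u \<alpha> * (\<Sum>\<beta>\<in>greek S. \<Sum>i=1..DIM('s). calT S \<tau> b i \<gamma> * calF S i \<alpha> \<beta> \<gamma> * u \<beta>))"
      \<comment> \<open>Instantiating the ranges orients \<open>sum.swap\<close>, so that rewriting
        with it does not loop and both sides reach the same order of summation.\<close>
      by (simp add: sum_distrib_left sum.swap[of _ "greek S" "{1..DIM('s)}"] mult_ac)
    also have "\<dots> = - (\<Sum>l=1..DIM('s). \<tau> b l * (\<Sum>\<alpha>\<in>greek S. u \<alpha> *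
        (\<Sum>j=1..DIM('x). dGam S j (frameE S l \<alpha>) \<gamma> * covcomp S \<gamma>' j)))"
      unfolding F
      by (simp add: sum_distrib_left sum.swap[of _ "greek S" "{1..DIM('s)}"] sum_negf mult_ac)
    finally have *: "(\<Sum>i=1..DIM('s). \<Sum>\<alpha>\<in>greek S. \<Sum>\<beta>\<in>greek S. calT S \<tau> b i \<gamma> * calF S i \<alpha> \<beta> \<gamma> * u \<alpha> * u \<beta>)
        = \<dots>" .
    have "(\<Sum>\<alpha>\<in>greek S. calT S \<tau> b \<alpha> \<gamma> * u' \<alpha>) = (\<Sum>l=1..DIM('s). \<tau> b l * (\<Sum>\<alpha>\<in>greek S. u' \<alpha> * frameE S l \<alpha> \<gamma>))"
      by (simp add: calT_def sum_distrib_left sum_distrib_right sum.swap[of _ "greek S" "{1..DIM('s)}"] mult_ac)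
    then show ?thesis
      unfolding * coord_rate_def by (simp add: sum.distrib distrib_left)
  qed
  show ?thesis
    unfolding control_law_def inner by (simp add: sum_negf)
qed

section \<open>Rotor equations as vector equations for the accelerations\<close>

lemma coupling_derivative:
  assumes v: "\<And>\<alpha>. \<alpha> \<in> greek S \<Longrightarrow> ((\<lambda>s. v s \<alpha>) has_real_derivative v' \<alpha>) (at t)"
    and \<Gamma>: "(\<Gamma> has_vector_derivative \<Gamma>') (at t)"
    and kinematic: "\<And>j. j \<in> {1..DIM('x)} \<Longrightarrow> covcomp S \<Gamma>' j =
      - (\<Sum>k=1..DIM('x). \<Sum>\<beta>\<in>greek S. varkappa S k j \<beta> (\<Gamma> t) * v t \<beta> * covcomp S (\<Gamma> t) k)"
  obtains c' where
    "((\<lambda>s. rotor_coupling S (xi_c S (v s) (\<Gamma> s))) has_vector_derivative c') (at t)"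
    "(\<chi> a. control_law S \<tau> (v t) v' (\<Gamma> t) a) = Grr S *v (matrix_inv \<sigma> *v c')"
proof
  define y where "y = coord_rate (v t) v' (\<Gamma> t) \<Gamma>'"
  \<comment> \<open>The coupling vector has constant coefficients in the fixed basis, so its
    derivative has the same coefficients applied to the rates \<open>y\<close>.\<close>
  let ?c' = "\<chi> a. \<Sum>i=1..DIM('s). Gsr S i a * y i"
  show "((\<lambda>s. rotor_coupling S (xi_c S (v s) (\<Gamma> s))) has_vector_derivative ?c') (at t)"
    unfolding has_vector_derivative_vec_iff rotor_coupling_def y_def
    by (auto intro!: derivative_eq_intros coord_xi_c_has_real_derivative v \<Gamma> simp: mult.commute)
  \<comment> \<open>By the choice of \<tau>, this vector is minus the rate of
    \<open>\<tau> \<xi>\<close>, which is what the control law multiplies by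
    \<open>Grr S\<close>.\<close>
  have "(matrix_inv \<sigma> *v ?c') $ b = - (\<Sum>l=1..DIM('s). \<tau> b l * y l)" for b
    unfolding matrix_vector_mult_def using tau
    by (simp add: sum_negf sum_distrib_left sum_distrib_right sum.swap[of _ UNIV] mult_ac)
  moreover have "control_law S \<tau> (v t) v' (\<Gamma> t) a
      = - (\<Sum>b\<in>UNIV. Grr S $ a $ b * (\<Sum>l=1..DIM('s). \<tau> b l * y l))" for a
    unfolding y_def by (rule control_law_eq) (rule kinematic)
  ultimately show "(\<chi> a. control_law S \<tau> (v t) v' (\<Gamma> t) a) = Grr S *v (matrix_inv \<sigma> *v ?c')"
    by (simp add: vec_eq_iff matrix_vector_mult_def[of "Grr S"] sum_negf)
qed

text \<open>Matching gives \<open>Grr S *v (matrix_inv \<rho> *v c') = c' - Grr S *v (matrix_inv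
  \<sigma> *v c')\<close>. Since \<open>Grr S\<close> and \<rho> are invertible, both equations then
  reduce to \<open>matrix_inv \<rho> *v c' + q' = 0\<close>.\<close>

lemma matching_accelerations:
  "c' + Grr S *v q' = Grr S *v (matrix_inv \<sigma> *v c') \<longleftrightarrow> c' + \<rho> *v q' = 0"
proof -
  have "Grr S *v (matrix_inv \<rho> *v c') + Grr S *v (matrix_inv \<sigma> *v c') = c'"
    by (subst add.commute)
      (simp add: matching_vector matrix_inv_vector[OF inv_G] flip: matrix_vector_right_distrib)
  then have "Grr S *v (matrix_inv \<rho> *v c') = c' - Grr S *v (matrix_inv \<sigma> *v c')"
    by (rule add_implies_diff)
  then have "c' + Grr S *v q' = Grr S *v (matrix_inv \<sigma> *v c') \<longleftrightarrow>
      Grr S *v (matrix_inv \<rho> *v c' + q') = 0"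
    by (simp add: matrix_vector_right_distrib diff_add_eq)
  also have "\<dots> \<longleftrightarrow> matrix_inv \<rho> *v c' + q' = 0"
    by (metis matrix_inv_vector(1)[OF inv_G] matrix_vector_mult_0_right)
  also have "\<dots> \<longleftrightarrow> \<rho> *v (matrix_inv \<rho> *v c' + q') = 0"
    by (metis matrix_inv_vector(1)[OF inv_rho] matrix_vector_mult_0_right)
  also have "\<dots> \<longleftrightarrow> c' + \<rho> *v q' = 0"
    by (simp add: matrix_vector_right_distrib matrix_inv_vector[OF inv_rho])
  finally show ?thesis .
qed

text \<open>The left side prescribes a derivative already known to be \<open>c' + M *v q'\<close>;
  uniqueness of derivatives makes this an equation between vectors.\<close>

lemma momentum_derivative_iff:
  assumes "(c has_vector_derivative c') (at t)" "(q has_vector_derivative q') (at t)"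
  shows "(\<forall>a. ((\<lambda>s. (c s + M *v q s) $ a) has_real_derivative u a) (at t))
    \<longleftrightarrow> c' + M *v q' = (\<chi> a. u a)"
proof -
  have "((\<lambda>s. c s + M *v q s) has_vector_derivative c' + M *v q') (at t)"
    by (intro has_vector_derivative_add assms
        bounded_linear.has_vector_derivative[OF matrix_vector_mul_bounded_linear])
  moreover have "(\<forall>a. ((\<lambda>s. (c s + M *v q s) $ a) has_real_derivative u a) (at t))
    \<longleftrightarrow> ((\<lambda>s. c s + M *v q s) has_vector_derivative (\<chi> a. u a)) (at t)"
    unfolding has_vector_derivative_vec_iff by simp
  ultimately show ?thesis
    using vector_derivative_unique_at by auto
qed

end

section \<open>Comparison of the two systems at a fixed time\<close>

theorem proposition16:
  fixes S :: "('g, 's::euclidean_space, 'x::euclidean_space, 'h::finite) rotor_system"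
    and \<tau> :: "'h \<Rightarrow> nat \<Rightarrow> real"
    and \<sigma> \<rho> :: "real^'h^'h"
    and I :: "real set"
    and v :: "real \<Rightarrow> nat \<Rightarrow> real"
    and \<theta>' :: "real \<Rightarrow> real^'h"
    and \<Gamma> :: "real \<Rightarrow> 'x \<Rightarrow>\<^sub>L real"
  assumes "rotor_setting S"
    and "transpose \<sigma> = \<sigma>" and "invertible \<sigma>"
    and "transpose \<rho> = \<rho>" and "invertible \<rho>"
    and "\<forall>a. \<forall>i\<in>{1..DIM('s)}. \<tau> a i = - (\<Sum>b\<in>UNIV. matrix_inv \<sigma> $ a $ b * Gsr S i b)"
    and "matrix_inv \<sigma> + matrix_inv \<rho> = matrix_inv (Grr S)"
    and "open I"
    and "\<forall>\<alpha>\<in>greek S. (\<lambda>t. v t \<alpha>) differentiable_on I"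
    and "\<theta>' differentiable_on I"
    and "\<Gamma> differentiable_on I"
  shows "\<forall>t\<in>I.
    (let law = control_law S \<tau> (v t) (\<lambda>\<alpha>. deriv (\<lambda>s. v s \<alpha>) t) (\<Gamma> t);
         C = (\<lambda>u. euler_poincare S (lagr S) u v \<theta>' \<Gamma> t);
         M = euler_poincare S (ctrl_lagr S \<tau> \<sigma> \<rho>) (\<lambda>a. 0) v \<theta>' \<Gamma> t
     in (C law \<longleftrightarrow> M) \<and> (\<forall>u. C u \<and> M \<longrightarrow> u = law))"
proof (intro ballI)
  fix t assume t: "t \<in> I"
  interpret matched_rotor_system S \<tau> \<sigma> \<rho>
    using assms(1,3-7) by unfold_locales
  have at: "f differentiable (at t)" if "f differentiable_on I" for f :: "real \<Rightarrow> 'b::real_normed_vector"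
    using that t \<open>open I\<close> by (simp add: differentiable_on_eq_differentiable_at)
  define v' where "v' = (\<lambda>\<alpha>. deriv (\<lambda>s. v s \<alpha>) t)"
  define law where "law = control_law S \<tau> (v t) v' (\<Gamma> t)"
  define c where "c = (\<lambda>s. rotor_coupling S (xi_c S (v s) (\<Gamma> s)))"
  \<comment> \<open>This conjunct of \<open>euler_poincare\<close> does not involve the Lagrangian,
    so both systems contain it and it may be assumed when the rotor equations are compared.\<close>
  define kinematic where "kinematic \<longleftrightarrow> (\<forall>i\<in>{1..DIM('x)}.
        ((\<lambda>s. covcomp S (\<Gamma> s) i) has_real_derivative
          - (\<Sum>k=1..DIM('x). \<Sum>\<beta>\<in>greek S.
               varkappa S k i \<beta> (\<Gamma> t) * v t \<beta> * covcomp S (\<Gamma> t) k)) (at t))"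
  have v: "((\<lambda>s. v s \<alpha>) has_real_derivative v' \<alpha>) (at t)" if "\<alpha> \<in> greek S" for \<alpha>
    unfolding v'_def using at[of "\<lambda>s. v s \<alpha>"] assms(9) that
    by (simp add: DERIV_deriv_iff_real_differentiable)
  obtain q' where q: "(\<theta>' has_vector_derivative q') (at t)"
    using at[OF assms(10)] vector_derivative_works by blast
  obtain \<Gamma>' where \<Gamma>: "(\<Gamma> has_vector_derivative \<Gamma>') (at t)"
    using at[OF assms(11)] vector_derivative_works by blast
  have rotors: "(\<forall>a. ((\<lambda>s. rotor_mom S (lagr S) a (v s) (\<theta>' s) (\<Gamma> s)) has_real_derivative law a) (at t))
      \<longleftrightarrow> (\<forall>a. ((\<lambda>s. rotor_mom S (ctrl_lagr S \<tau> \<sigma> \<rho>) a (v s) (\<theta>' s) (\<Gamma> s)) has_real_derivative 0) (at t))"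
    if kinematic
  proof -
    have "((\<lambda>s. covcomp S (\<Gamma> s) i) has_real_derivative covcomp S \<Gamma>' i) (at t)" for i
      unfolding covcomp_def has_real_derivative_iff_has_vector_derivative
      by (rule bounded_linear.has_vector_derivative[OF blinfun.bounded_linear_left \<Gamma>])
    then have "covcomp S \<Gamma>' i =
        - (\<Sum>k=1..DIM('x). \<Sum>\<beta>\<in>greek S. varkappa S k i \<beta> (\<Gamma> t) * v t \<beta> * covcomp S (\<Gamma> t) k)"
      if "i \<in> {1..DIM('x)}" for i
      using \<open>kinematic\<close> that DERIV_unique unfolding kinematic_def by blast
    from coupling_derivative[OF v \<Gamma> this] obtain c' where
      c: "(c has_vector_derivative c') (at t)" and
      law: "(\<chi> a. law a) = Grr S *v (matrix_inv \<sigma> *v c')"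
      unfolding law_def c_def by blast
    show ?thesis
      unfolding rotor_mom_lagr rotor_mom_ctrl_lagr c_def[symmetric]
      using momentum_derivative_iff[OF c q, of "Grr S" law] law
        momentum_derivative_iff[OF c q, of \<rho> "\<lambda>a. 0"] matching_accelerations[of c' q']
      by (simp add: c_def zero_vec_def)
  qed
  \<comment> \<open>The equations for the momenta \<open>mom\<close> coincide literally by
    \<open>mom_ctrl_lagr\<close>, so only the rotor equations need an argument.\<close>
  have eq: "euler_poincare S (lagr S) law v \<theta>' \<Gamma> t
      \<longleftrightarrow> euler_poincare S (ctrl_lagr S \<tau> \<sigma> \<rho>) (\<lambda>a. 0) v \<theta>' \<Gamma> t"
    unfolding euler_poincare_def mom_ctrl_lagr kinematic_def[symmetric] using rotors by blast
  \<comment> \<open>Both torques are the derivative of the same rotor momentum at \<open>t\<close>.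
    The second premise will come from the controlled Lagrangian's system through
    \<open>eq\<close>.\<close>
  moreover have "u = law"
    if "euler_poincare S (lagr S) u v \<theta>' \<Gamma> t" "euler_poincare S (lagr S) law v \<theta>' \<Gamma> t" for u
    using that DERIV_unique unfolding euler_poincare_def by blast
  ultimately show "let law = control_law S \<tau> (v t) (\<lambda>\<alpha>. deriv (\<lambda>s. v s \<alpha>) t) (\<Gamma> t);
         C = (\<lambda>u. euler_poincare S (lagr S) u v \<theta>' \<Gamma> t);
         M = euler_poincare S (ctrl_lagr S \<tau> \<sigma> \<rho>) (\<lambda>a. 0) v \<theta>' \<Gamma> t
     in (C law \<longleftrightarrow> M) \<and> (\<forall>u. C u \<and> M \<longrightarrow> u = law)"
    unfolding Let_def v'_def[symmetric] law_def[symmetric] by blast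
qed

end
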